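(* A simple equation $[D]$ is spineless if and only if it satisfies $(\star\star K)$ for every sufficiently large integer $K$.
   Context: Simple and basic equations (over commutative residuated lattices): for $n\ge 1$ and a column vector $d\in\mathbb{N}^n$ (here $0\in\mathbb{N}$) let $\mathbf{x}_n^{d}:=x_1^{d(1)}\cdots x_n^{d(n)}$; $\mathbf{1}$ is the all-ones vector. A simple equation in $n$ variables is $[D]:\ x_1\cdots x_n\le\bigvee_{d\in D}\mathbf{x}_n^{d}$, where $D\subseteq\mathbb{N}^n$ is finite, nonempty, and for each $i\le n$ some $d\in D$ has $d(i)\ne0$. A basic equation in $k$ variables is $[f,A]:\ \mathbf{x}_k^{f}\le\bigvee_{a\in A}\mathbf{x}_k^{a}$ with $f\in(\mathbb{Z}^+)^k$ and $A\subseteq\mathbb{N}^k$ finite and nonempty such that for each $i\le k$ some $a\in A$ has $a(i)\neq 0$. Spinal, prespinal, spineless: a basic equation $[f,V]$ in $k\ge1$ variables is spinal if $f\notin V$ and $V$ is either $\{v_1,\dots,v_k\}$ or $\{0,v_1,\dots,v_k\}$ ($0$ the zero vector), where $v_j(j)\ne0$ for all $j\le k$ and $v_i(j)=0$ whenever $1\le i<j\le k$. A simple equation $[D]$ in $n$ variables is prespinal if there are $k\ge1$ and a $k\times n$ matrix $\Sigma$ with entries in $\mathbb{N}$ (encoding the monoid substitution $x_j\mapsto x_1^{\Sigma_{1j}}\cdots x_k^{\Sigma_{kj}}$) such that $[\Sigma\mathbf{1},\{\Sigma d:d\in D\}]$ is a spinal equation. A simple equation is spineless if it is not prespinal. Condition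 $(\star\star K)$, for an integer $K>1$: for row vectors $\sigma\in\mathbb{N}^n$ and column vectors $d\in\mathbb{N}^n$ let $\sigma d=\sum_i\sigma(i)d(i)$. $[D]$ (in $n$ variables) satisfies $(\star\star K)$ if for all $\sigma,\sigma'\in\mathbb{N}^n$ and all $C,C'\in\mathbb{N}$: if $C+\sigma d$ and $C'+\sigma'd$ are powers of $K$ (i.e. in $\{K^m:m\in\mathbb{N}\}$) for each $d\in D$, then there exists $\bar d\in D$ such that $\sigma\bar d=\sigma\mathbf{1}$ and $\sigma'\bar d=\sigma'\mathbf{1}$. *)

theory Defs
  imports "Jordan_Normal_Form.Matrix"
begin

text \<open>
  The simple equation \<open>x\<^sub>1\<cdots>x\<^sub>n \<le> \<Or>\<^bsub>d \<in> D\<^esub> x\<^sup>d\<close> is represented by its data \<open>n\<close> and \<open>D\<close>,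
  and the basic equation \<open>x\<^sup>f \<le> \<Or>\<^bsub>a \<in> A\<^esub> x\<^sup>a\<close> by \<open>k\<close>, \<open>f\<close> and \<open>A\<close>. Exponent vectors have
  entries in \<open>nat\<close>, and their coordinates are indexed from \<open>0\<close>.
\<close>

definition simple_equation :: "nat \<Rightarrow> nat vec set \<Rightarrow> bool" where
  "simple_equation n D \<longleftrightarrow>
     n \<ge> 1 \<and> finite D \<and> D \<noteq> {} \<and> D \<subseteq> carrier_vec n \<and> (\<forall>i<n. \<exists>d\<in>D. d $ i \<noteq> 0)"

definition basic_equation :: "nat \<Rightarrow> nat vec \<Rightarrow> nat vec set \<Rightarrow> bool" where
  "basic_equation k f A \<longleftrightarrow>
     f \<in> carrier_vec k \<and> (\<forall>i<k. f $ i > 0) \<and>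
     finite A \<and> A \<noteq> {} \<and> A \<subseteq> carrier_vec k \<and> (\<forall>i<k. \<exists>a\<in>A. a $ i \<noteq> 0)"

definition spinal :: "nat \<Rightarrow> nat vec \<Rightarrow> nat vec set \<Rightarrow> bool" where
  "spinal k f V \<longleftrightarrow>
     k \<ge> 1 \<and> basic_equation k f V \<and> f \<notin> V \<and>
     (\<exists>v :: nat \<Rightarrow> nat vec.
        (V = v ` {..<k} \<or> V = insert (0\<^sub>v k) (v ` {..<k})) \<and>
        (\<forall>j<k. v j $ j \<noteq> 0) \<and>
        (\<forall>i j. i < j \<and> j < k \<longrightarrow> v i $ j = 0))"

abbreviation ones_vec :: "nat \<Rightarrow> nat vec" where
  "ones_vec n \<equiv> vec n (\<lambda>_. 1)"

text \<open>
  The matrix \<open>S\<close> encodes the monoid substitution sending \<open>x\<^sub>j\<close> to the monomial whose exponent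
  vector is column \<open>j\<close> of \<open>S\<close>; it sends a monomial with exponent vector \<open>d\<close> to the one with
  exponent vector \<open>S *\<^sub>v d\<close>.
\<close>

definition prespinal :: "nat \<Rightarrow> nat vec set \<Rightarrow> bool" where
  "prespinal n D \<longleftrightarrow>
     (\<exists>k\<ge>1. \<exists>S \<in> carrier_mat k n. spinal k (S *\<^sub>v ones_vec n) ((\<lambda>d. S *\<^sub>v d) ` D))"

definition spineless :: "nat \<Rightarrow> nat vec set \<Rightarrow> bool" where
  "spineless n D \<longleftrightarrow> simple_equation n D \<and> \<not> prespinal n D"

definition star_star :: "nat \<Rightarrow> nat \<Rightarrow> nat vec set \<Rightarrow> bool" where
  "star_star K n D \<longleftrightarrow>
     (\<forall>\<sigma> \<in> carrier_vec n. \<forall>\<sigma>' \<in> carrier_vec n. \<forall>C C' :: nat.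
        (\<forall>d\<in>D. C + \<sigma> \<bullet> d \<in> range (\<lambda>m::nat. K ^ m) \<and> C' + \<sigma>' \<bullet> d \<in> range (\<lambda>m::nat. K ^ m)) \<longrightarrow>
        (\<exists>e\<in>D. \<sigma> \<bullet> e = \<sigma> \<bullet> ones_vec n \<and> \<sigma>' \<bullet> e = \<sigma>' \<bullet> ones_vec n))"

end

theory Submission
  imports Defs "HOL-Number_Theory.Cong"
begin

text \<open>
  Think of \<open>\<sigma> \<in> \<nat>\<^sup>n\<close> as a weighting of the variables, and of \<open>d \<mapsto> \<sigma> \<bullet> d\<close> as sorting \<open>D\<close> into
  finitely many levels.

  Suppose that every \<open>C + \<sigma> \<bullet> d\<close> is a power of a large \<open>K\<close>. Then each level is a large multiple
  of the one below it; the weighting is \<^emph>\<open>lacunary\<close>. The weightings that are constant on each class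
  of a fixed partition of \<open>D\<close> form a monoid with finitely many minimal nonzero elements, by Dickson's
  lemma. If all of these that are positive on a given class were also positive somewhere below it,
  then the ratio of \<open>\<sigma>\<close> between that class and the classes below would be bounded independently of
  \<open>K\<close>, because \<open>\<sigma>\<close> is a sum of minimal elements. So for large \<open>K\<close> every positive level has a
  \<^emph>\<open>separator\<close>: a weighting that is constant on the levels of \<open>\<sigma>\<close>, positive on the given level and
  zero below it (\<open>lacunary_imp_separator\<close>).

  Separators of successive levels, used as the rows of a matrix, bring \<open>D\<close> into the triangular shape
  of a spine. What remains is that the image of the all-ones vector must be missed. A weighting for
  which \<open>\<sigma> \<bullet> \<one>\<close> is not the maximum of \<open>\<sigma>\<close> on \<open>D\<close> achieves this when \<open>\<sigma>\<close> itself serves as the first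
  row (\<open>missed_maximum_imp_prespinal\<close>). So for a spineless equation \<open>\<sigma> \<bullet> \<one>\<close> and \<open>\<sigma>' \<bullet> \<one>\<close> are the
  respective maxima. If no element of \<open>D\<close> attained both maxima, the separators of the two top
  levels would have disjoint supports in \<open>D\<close> and form a spine of length two
  (\<open>disjoint_tops_imp_prespinal\<close>). Hence the condition holds for all large \<open>K\<close>.

  Conversely, the triangular system of conditions ``\<open>1 + w \<bullet> v\<^sub>j\<close> is a power of \<open>K\<close>'' for a spine
  \<open>v\<^sub>1, \<dots>, v\<^sub>k\<close> is solved one coordinate at a time if the diagonal entries divide \<open>K - 1\<close>, and the
  weights can be made to grow as fast as desired (\<open>triangular_power_solution\<close>). Fast growth makes
  \<open>w\<close> injective on vectors with bounded entries, so \<open>w \<bullet> f\<close> differs from all \<open>w \<bullet> v\<close> with \<open>v \<in> V\<close>.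
  Pulling \<open>w\<close> back along the substitution violates the condition, for arbitrarily large \<open>K\<close>.
\<close>

section \<open>Dickson's lemma and ratio bounds\<close>

text \<open>
  A decreasing sequence of natural numbers is eventually constant, so the decreasing case of the
  monotone subsequence theorem reduces to the increasing one.
\<close>

lemma nat_seq_mono_subseq:
  fixes s :: "nat \<Rightarrow> nat"
  shows "\<exists>r :: nat \<Rightarrow> nat. strict_mono r \<and> mono (\<lambda>k. s (r k))"
proof -
  obtain f where f: "strict_mono f" "monoseq (\<lambda>k. s (f k))"
    using seq_monosub by blast
  show ?thesis
  proof (cases "incseq (\<lambda>k. s (f k))")
    case True
    with f show ?thesis by blast
  next
    case False
    with f(2) have dec: "decseq (\<lambda>k. s (f k))"
      by (auto simp: monoseq_iff)
    obtain N where N: "\<And>k. s (f N) \<le> s (f k)"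
      using ex_has_least_nat[of "\<lambda>_. True" _ "\<lambda>k. s (f k)"] by auto
    have const: "s (f (k + N)) = s (f N)" for k
      using N[of "k + N"] decseqD[OF dec, of N "k + N"] by simp
    have "strict_mono (\<lambda>k. f (k + N))"
      using f(1) by (auto simp: strict_mono_def)
    moreover have "mono (\<lambda>k. s (f (k + N)))"
      by (simp add: const mono_def)
    ultimately show ?thesis by blast
  qed
qed

text \<open>
  Dickson's lemma: thin out the sequence once for each coordinate. Thinning out further keeps the
  coordinates already treated monotone.
\<close>

lemma dickson_subsequence:
  fixes s :: "nat \<Rightarrow> nat \<Rightarrow> nat"
  shows "\<exists>r :: nat \<Rightarrow> nat. strict_mono r \<and> (\<forall>i<n. mono (\<lambda>k. s (r k) i))"
proof (induction n)
  case 0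
  show ?case by (rule exI[of _ id]) (simp add: strict_mono_def)
next
  case (Suc n)
  then obtain r :: "nat \<Rightarrow> nat"
    where r: "strict_mono r" "\<And>i. i < n \<Longrightarrow> mono (\<lambda>k. s (r k) i)" by blast
  obtain q :: "nat \<Rightarrow> nat" where q: "strict_mono q" "mono (\<lambda>k. s (r (q k)) n)"
    using nat_seq_mono_subseq[of "\<lambda>k. s (r k) n"] by blast
  have "strict_mono (\<lambda>k. r (q k))"
    using r(1) q(1) by (simp add: strict_mono_def)
  moreover have "mono (\<lambda>k. s (r (q k)) i)" if "i < Suc n" for i
  proof (cases "i = n")
    case True
    with q(2) show ?thesis by simp
  next
    case False
    with that have "mono (\<lambda>k. s (r k) i)" by (intro r(2)) simp
    with strict_mono_mono[OF q(1)] show ?thesis by (simp add: mono_def)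
  qed
  ultimately show ?case by blast
qed

text \<open>Among infinitely many minimal vectors Dickson's lemma would find two comparable ones.\<close>

lemma finite_minimal_vectors:
  fixes M :: "nat vec set"
  assumes M: "M \<subseteq> carrier_vec n"
  shows "finite {g \<in> M. \<forall>h\<in>M. h \<le> g \<longrightarrow> h = g}" (is "finite ?G")
proof (rule ccontr)
  assume "infinite ?G"
  then obtain s :: "nat \<Rightarrow> nat vec" where s: "inj s" "range s \<subseteq> ?G"
    using infinite_countable_subset by blast
  obtain r :: "nat \<Rightarrow> nat"
    where r: "strict_mono r" "\<And>i. i < n \<Longrightarrow> mono (\<lambda>k. s (r k) $ i)"
    using dickson_subsequence[of n "\<lambda>k i. s k $ i"] by blast
  have car: "s k \<in> carrier_vec n" and G: "s k \<in> ?G" for k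
    using s(2) M by auto
  have "s (r 0) \<le> s (r 1)"
    unfolding less_eq_vec_def using car[THEN carrier_vecD] r(2) by (simp add: mono_def)
  with G[of "r 0"] G[of "r 1"] have "s (r 0) = s (r 1)" by blast
  then have "r 0 = r 1" using s(1) by (simp add: inj_eq)
  then show False using strict_monoD[OF r(1), of 0 1] by simp
qed

text \<open>
  The equalities are recorded as a set of pairs, and not through a weighting inducing them, so that
  a finite \<open>D\<close> gives only finitely many of these monoids and bounds can be made uniform.
\<close>

definition balanced :: "nat \<Rightarrow> (nat vec \<times> nat vec) set \<Rightarrow> nat vec set" where
  "balanced n E = {\<sigma> \<in> carrier_vec n. \<forall>(d, e) \<in> E. \<sigma> \<bullet> d = \<sigma> \<bullet> e}"

lemma le_vec_complement:
  fixes g s :: "nat vec"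
  assumes "g \<in> carrier_vec n" "s \<in> carrier_vec n" "g \<le> s"
  shows "s = g + (s - g)" "s - g \<in> carrier_vec n"
proof -
  show "s - g \<in> carrier_vec n" using assms by (intro carrier_vecI) simp
  show "s = g + (s - g)"
    using assms by (intro eq_vecI) (auto simp: less_eq_vec_def)
qed

text \<open>
  The bound is clear for a minimal nonzero element \<open>g\<close> of the monoid: either \<open>g \<bullet> x = 0\<close>, or the sum
  over \<open>L\<close> is at least \<open>1\<close>. Both sides are additive, the monoid is closed under the subtraction
  of an element below, and there are finitely many minimal elements; so the bound extends to
  all elements by splitting off minimal ones.
\<close>

lemma balanced_ratio_bound:
  assumes E: "E \<subseteq> carrier_vec n \<times> carrier_vec n"
    and x: "x \<in> carrier_vec n" and L: "L \<subseteq> carrier_vec n" "finite L"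
    and no_sep: "\<And>g. g \<in> balanced n E \<Longrightarrow> \<forall>e\<in>L. g \<bullet> e = 0 \<Longrightarrow> g \<bullet> x = 0"
  shows "\<exists>B. \<forall>\<sigma>\<in>balanced n E. \<sigma> \<bullet> x \<le> B * (\<Sum>e\<in>L. \<sigma> \<bullet> e)"
proof -
  define M where "M = balanced n E - {0\<^sub>v n}"
  define G where "G = {g \<in> M. \<forall>h\<in>M. h \<le> g \<longrightarrow> h = g}"
  have Mcar: "M \<subseteq> carrier_vec n" by (auto simp: M_def balanced_def)
  have finG: "finite G" unfolding G_def by (rule finite_minimal_vectors[OF Mcar])
  define B where "B = (\<Sum>g\<in>G. g \<bullet> x)"
  have wt: "h \<le> g \<Longrightarrow> h \<noteq> g \<Longrightarrow> g \<in> carrier_vec n \<Longrightarrow> (\<Sum>i<n. h $ i) < (\<Sum>i<n. g $ i)" for h g :: "nat vec"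
  proof (rule sum_strict_mono_ex1)
    assume a: "h \<le> g" "h \<noteq> g" "g \<in> carrier_vec n"
    show "\<forall>i\<in>{..<n}. h $ i \<le> g $ i" using a by (auto simp: less_eq_vec_def)
    show "\<exists>i\<in>{..<n}. h $ i < g $ i"
    proof (rule ccontr)
      assume "\<not> ?thesis"
      with a have "h = g"
        by (intro eq_vecI) (auto simp: less_eq_vec_def not_less intro!: antisym)
      with a show False by simp
    qed
  qed simp
  have below: "\<exists>g\<in>G. g \<le> s" if "s \<in> M" for s
    using that
  proof (induction "\<Sum>i<n. s $ i" arbitrary: s rule: less_induct)
    case less
    show ?case
    proof (cases "s \<in> G")
      case True
      then show ?thesis by auto
    next
      case False
      with less.prems obtain h where h: "h \<in> M" "h \<le> s" "h \<noteq> s" by (auto simp: G_def)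
      with less.prems Mcar have "(\<Sum>i<n. h $ i) < (\<Sum>i<n. s $ i)" by (intro wt) auto
      from less.hyps[OF this h(1)] h(2) show ?thesis by (meson order_trans)
    qed
  qed
  have "s \<bullet> x \<le> B * (\<Sum>e\<in>L. s \<bullet> e)" if "s \<in> balanced n E" for s
    using that
  proof (induction "\<Sum>i<n. s $ i" arbitrary: s rule: less_induct)
    case less
    have scar: "s \<in> carrier_vec n" using less.prems by (simp add: balanced_def)
    show ?case
    proof (cases "s = 0\<^sub>v n")
      case True
      with x show ?thesis by simp
    next
      case False
      with less.prems obtain g where g: "g \<in> G" "g \<le> s"
        using below[of s] by (auto simp: M_def)
      then have gb: "g \<in> balanced n E" and gnz: "g \<noteq> 0\<^sub>v n"
        by (auto simp: G_def M_def)
      then have gcar: "g \<in> carrier_vec n" by (simp add: balanced_def)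
      define t where "t = s - g"
      have st: "s = g + t" and tcar: "t \<in> carrier_vec n"
        using le_vec_complement[OF gcar scar g(2)] by (auto simp: t_def)
      have add: "s \<bullet> y = g \<bullet> y + t \<bullet> y" if "y \<in> carrier_vec n" for y
        unfolding st by (rule add_scalar_prod_distrib[OF gcar tcar that])
      have "t \<bullet> d = t \<bullet> e" if de: "(d, e) \<in> E" for d e
      proof -
        have "d \<in> carrier_vec n" "e \<in> carrier_vec n" using de E by auto
        moreover have "s \<bullet> d = s \<bullet> e" "g \<bullet> d = g \<bullet> e"
          using de less.prems gb by (auto simp: balanced_def)
        ultimately show ?thesis using add[of d] add[of e] by simp
      qed
      then have tb: "t \<in> balanced n E" using tcar by (auto simp: balanced_def)
      have "t \<le> s" "t \<noteq> s"
      proof -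
        show "t \<le> s" using st gcar tcar by (auto simp: less_eq_vec_def)
        show "t \<noteq> s"
        proof
          assume "t = s"
          then have "g $ i = 0" if "i < n" for i
            using st that gcar tcar
            by (metis add_eq_self_zero add.commute carrier_vecD index_add_vec(1))
          then have "g = 0\<^sub>v n" using gcar by (intro eq_vecI) auto
          with gnz show False by simp
        qed
      qed
      then have "(\<Sum>i<n. t $ i) < (\<Sum>i<n. s $ i)" by (rule wt) (fact scar)
      then have IH: "t \<bullet> x \<le> B * (\<Sum>e\<in>L. t \<bullet> e)" by (rule less.hyps[OF _ tb])
      have gx: "g \<bullet> x \<le> B * (\<Sum>e\<in>L. g \<bullet> e)"
      proof (cases "\<forall>e\<in>L. g \<bullet> e = 0")
        case True
        with no_sep[OF gb] show ?thesis by simp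
      next
        case False
        then have "1 \<le> (\<Sum>e\<in>L. g \<bullet> e)" using L(2)
          by (simp add: Suc_le_eq) (metis neq0_conv sum_eq_0_iff)
        moreover have "g \<bullet> x \<le> B"
          unfolding B_def using finG g(1) by (intro member_le_sum) auto
        ultimately show ?thesis using mult_le_mono[of "g \<bullet> x" B 1] by simp
      qed
      have "(\<Sum>e\<in>L. s \<bullet> e) = (\<Sum>e\<in>L. g \<bullet> e) + (\<Sum>e\<in>L. t \<bullet> e)"
        unfolding sum.distrib[symmetric] using L(1) by (intro sum.cong add) auto
      then show ?thesis using add[OF x] IH gx by (simp add: distrib_left)
    qed
  qed
  then show ?thesis by blast
qed

lemma uniform_bound:
  fixes P :: "'a \<Rightarrow> nat \<Rightarrow> bool"
  assumes "finite A" "\<And>a. a \<in> A \<Longrightarrow> \<exists>b. P a b"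
    and mono: "\<And>a b c. P a b \<Longrightarrow> b \<le> c \<Longrightarrow> P a c"
  shows "\<exists>b. \<forall>a\<in>A. P a b"
  using assms(1,2)
proof (induction A rule: finite_induct)
  case (insert a A)
  obtain b where "\<forall>a\<in>A. P a b" using insert by blast
  moreover obtain c where "P a c" using insert by blast
  ultimately have "P x (max b c)" if "x \<in> insert a A" for x
    using that mono[of x b "max b c"] mono[of x c "max b c"] by auto
  then show ?case by blast
qed simp

section \<open>Separators of lacunary weightings\<close>

definition lacunary :: "nat \<Rightarrow> nat vec set \<Rightarrow> nat vec \<Rightarrow> bool" where
  "lacunary L D \<sigma> \<longleftrightarrow> (\<forall>d\<in>D. \<forall>e\<in>D. \<sigma> \<bullet> d < \<sigma> \<bullet> e \<longrightarrow> L * (\<sigma> \<bullet> d) \<le> \<sigma> \<bullet> e)"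

text \<open>
  Read relative to the levels of \<open>\<sigma>\<close> on \<open>D\<close>: \<open>g\<close> respects the levels, and the lowest level on which
  it does not vanish is that of \<open>x\<close>. Nothing is asked of it above that level.
\<close>

definition separator :: "nat \<Rightarrow> nat vec set \<Rightarrow> nat vec \<Rightarrow> nat vec \<Rightarrow> nat vec \<Rightarrow> bool" where
  "separator n D \<sigma> x g \<longleftrightarrow> g \<in> carrier_vec n \<and>
     (\<forall>d\<in>D. \<forall>e\<in>D. \<sigma> \<bullet> d = \<sigma> \<bullet> e \<longrightarrow> g \<bullet> d = g \<bullet> e) \<and>
     0 < g \<bullet> x \<and> (\<forall>e\<in>D. \<sigma> \<bullet> e < \<sigma> \<bullet> x \<longrightarrow> g \<bullet> e = 0)"

lemma separatorD:
  assumes "separator n D \<sigma> x g"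
  shows "g \<in> carrier_vec n" "0 < g \<bullet> x"
    and "\<And>d e. d \<in> D \<Longrightarrow> e \<in> D \<Longrightarrow> \<sigma> \<bullet> d = \<sigma> \<bullet> e \<Longrightarrow> g \<bullet> d = g \<bullet> e"
    and "\<And>e. e \<in> D \<Longrightarrow> \<sigma> \<bullet> e < \<sigma> \<bullet> x \<Longrightarrow> g \<bullet> e = 0"
  using assms unfolding separator_def by blast+

text \<open>
  Without a separator, \<open>balanced_ratio_bound\<close> bounds \<open>\<sigma> \<bullet> x\<close> by a multiple of the values of \<open>\<sigma>\<close> below
  it. Only finitely many triples of a set of equalities, a point and a set of lower points
  occur, so one multiplier \<open>B\<close> serves for every \<open>\<sigma>\<close>, and a gap larger than \<open>B * card D\<close> is a
  contradiction.
\<close>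

lemma lacunary_imp_separator:
  assumes D: "finite D" "D \<subseteq> carrier_vec n"
  shows "\<exists>L. \<forall>\<sigma>\<in>carrier_vec n. \<forall>x\<in>D.
           lacunary L D \<sigma> \<longrightarrow> 0 < \<sigma> \<bullet> x \<longrightarrow> (\<exists>g. separator n D \<sigma> x g)"
proof -
  define P where "P = (\<lambda>(E, x, L) B.
      (\<forall>g\<in>balanced n E. (\<forall>e\<in>L. g \<bullet> e = 0) \<longrightarrow> g \<bullet> x = 0) \<longrightarrow>
      (\<forall>\<sigma>\<in>balanced n E. \<sigma> \<bullet> x \<le> B * (\<Sum>e\<in>L. \<sigma> \<bullet> e)))"
  have "\<exists>B. \<forall>a\<in>Pow (D \<times> D) \<times> D \<times> Pow D. P a B"
  proof (rule uniform_bound)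
    show "finite (Pow (D \<times> D) \<times> D \<times> Pow D)" using D(1) by simp
  next
    fix a assume "a \<in> Pow (D \<times> D) \<times> D \<times> Pow D"
    then obtain E x L where a: "a = (E, x, L)" "E \<subseteq> D \<times> D" "x \<in> D" "L \<subseteq> D" by auto
    show "\<exists>B. P a B"
    proof (cases "\<forall>g\<in>balanced n E. (\<forall>e\<in>L. g \<bullet> e = 0) \<longrightarrow> g \<bullet> x = 0")
      case True
      have "\<exists>B. \<forall>\<sigma>\<in>balanced n E. \<sigma> \<bullet> x \<le> B * (\<Sum>e\<in>L. \<sigma> \<bullet> e)"
        using a D True by (intro balanced_ratio_bound) (auto intro: finite_subset)
      then show ?thesis by (auto simp: P_def a)
    qed (auto simp: P_def a)
  next
    fix a b c assume "P a b" "b \<le> (c::nat)"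
    moreover obtain E x L where a: "a = (E, x, L)" by (cases a) auto
    moreover have "b * m \<le> c * m" for m using \<open>b \<le> c\<close> by (rule mult_le_mono1)
    ultimately show "P a c" unfolding P_def by (auto intro: order_trans)
  qed
  then obtain B where "\<forall>a\<in>Pow (D \<times> D) \<times> D \<times> Pow D. P a B" ..
  then have B: "\<And>E x L. E \<subseteq> D \<times> D \<Longrightarrow> x \<in> D \<Longrightarrow> L \<subseteq> D \<Longrightarrow> P (E, x, L) B" by blast
  have "\<exists>g. separator n D \<sigma> x g"
    if s: "\<sigma> \<in> carrier_vec n" and x: "x \<in> D" and lac: "lacunary (B * card D + 1) D \<sigma>"
      and pos: "0 < \<sigma> \<bullet> x" for \<sigma> x
  proof (rule ccontr)
    assume none: "\<not> ?thesis"
    define E where "E = {(d, e) \<in> D \<times> D. \<sigma> \<bullet> d = \<sigma> \<bullet> e}"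
    define L where "L = {e \<in> D. \<sigma> \<bullet> e < \<sigma> \<bullet> x}"
    have "\<forall>g\<in>balanced n E. (\<forall>e\<in>L. g \<bullet> e = 0) \<longrightarrow> g \<bullet> x = 0"
    proof (intro ballI impI, rule ccontr)
      fix g assume g: "g \<in> balanced n E" "\<forall>e\<in>L. g \<bullet> e = 0" "g \<bullet> x \<noteq> 0"
      then have "separator n D \<sigma> x g"
        unfolding separator_def balanced_def E_def L_def by blast
      with none show False by blast
    qed
    moreover have "P (E, x, L) B" using x by (intro B) (auto simp: E_def L_def)
    moreover have "\<sigma> \<in> balanced n E" using s unfolding balanced_def E_def by blast
    ultimately have le: "\<sigma> \<bullet> x \<le> B * (\<Sum>e\<in>L. \<sigma> \<bullet> e)" unfolding P_def by blast
    have "(B * card D + 1) * (\<Sum>e\<in>L. \<sigma> \<bullet> e) = (\<Sum>e\<in>L. (B * card D + 1) * (\<sigma> \<bullet> e))"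
      by (rule sum_distrib_left)
    also have "\<dots> \<le> (\<Sum>e\<in>L. \<sigma> \<bullet> x)"
      using lac x by (intro sum_mono) (auto simp: L_def lacunary_def)
    also have "\<dots> \<le> card D * (\<sigma> \<bullet> x)"
      using D(1) by (simp add: L_def card_mono)
    finally have sum: "(B * card D + 1) * (\<Sum>e\<in>L. \<sigma> \<bullet> e) \<le> card D * (\<sigma> \<bullet> x)" .
    have "(B * card D + 1) * (\<sigma> \<bullet> x) \<le> (B * card D + 1) * (B * (\<Sum>e\<in>L. \<sigma> \<bullet> e))"
      using le by (rule mult_le_mono2)
    also have "\<dots> = B * ((B * card D + 1) * (\<Sum>e\<in>L. \<sigma> \<bullet> e))" by (rule mult.left_commute)
    also have "\<dots> \<le> B * (card D * (\<sigma> \<bullet> x))" using sum by (rule mult_le_mono2)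
    finally have "(B * card D + 1) * (\<sigma> \<bullet> x) \<le> B * card D * (\<sigma> \<bullet> x)"
      by (simp add: mult.assoc)
    with pos show False by simp
  qed
  then show ?thesis by blast
qed

text \<open>
  The shift \<open>C\<close> costs nothing: \<open>C + \<sigma> \<bullet> e\<close> is at least \<open>K\<close> times \<open>C + \<sigma> \<bullet> d\<close> if it is larger at all,
  and removing \<open>C\<close> from both can only increase their ratio.
\<close>

lemma power_values_imp_lacunary:
  assumes K: "L < K" and pow: "\<And>d. d \<in> D \<Longrightarrow> C + \<sigma> \<bullet> d \<in> range (\<lambda>m::nat. K ^ m)"
  shows "lacunary L D \<sigma>"
  unfolding lacunary_def
proof (intro ballI impI)
  fix d e assume de: "d \<in> D" "e \<in> D" "\<sigma> \<bullet> d < \<sigma> \<bullet> e"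
  obtain a b :: nat where ab: "C + \<sigma> \<bullet> d = K ^ a" "C + \<sigma> \<bullet> e = K ^ b"
    using pow[OF de(1)] pow[OF de(2)] by auto
  have "K ^ a < K ^ b" using ab de(3) by linarith
  then have "a < b" using K power_increasing[of b a K] by (cases "a < b") auto
  then have "K ^ Suc a \<le> K ^ b" using K by (intro power_increasing) auto
  then have "K * (C + \<sigma> \<bullet> d) \<le> C + \<sigma> \<bullet> e" using ab by simp
  moreover have "(L + 1) * (C + \<sigma> \<bullet> d) \<le> K * (C + \<sigma> \<bullet> d)" using K by (intro mult_le_mono1) simp
  ultimately have "L * (C + \<sigma> \<bullet> d) + (C + \<sigma> \<bullet> d) \<le> C + \<sigma> \<bullet> e" by simp
  then show "L * (\<sigma> \<bullet> d) \<le> \<sigma> \<bullet> e" by (simp add: distrib_left)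
qed

section \<open>Spinal equations from separators\<close>

lemma pos_scalar_prod_ones:
  fixes h x :: "nat vec"
  assumes "h \<in> carrier_vec n" "x \<in> carrier_vec n" "0 < h \<bullet> x"
  shows "0 < h \<bullet> ones_vec n"
proof (rule ccontr)
  assume "\<not> ?thesis"
  then have "\<forall>i<n. h $ i = 0" by (simp add: scalar_prod_def)
  with assms show False by (simp add: scalar_prod_def)
qed

text \<open>
  The rows \<open>h\<^sub>j\<close> form the substitution matrix, and \<open>e\<^sub>j \<in> D\<close> is a point mapped to the vector \<open>v\<^sub>j\<close> of
  the spine. Positivity of the image of the all-ones vector is automatic, since no row vanishes.
\<close>

lemma prespinalI:
  fixes h e :: "nat \<Rightarrow> nat vec"
  assumes D: "simple_equation n D" and k: "k \<ge> 1"
    and h: "\<And>j. j < k \<Longrightarrow> h j \<in> carrier_vec n"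
    and e: "\<And>j. j < k \<Longrightarrow> e j \<in> D"
    and diag: "\<And>j. j < k \<Longrightarrow> 0 < h j \<bullet> e j"
    and tri: "\<And>i j. i < j \<Longrightarrow> j < k \<Longrightarrow> h j \<bullet> e i = 0"
    and cover: "\<And>d. d \<in> D \<Longrightarrow> (\<forall>j<k. h j \<bullet> d = 0) \<or> (\<exists>i<k. \<forall>j<k. h j \<bullet> d = h j \<bullet> e i)"
    and sep: "\<And>d. d \<in> D \<Longrightarrow> \<exists>j<k. h j \<bullet> d \<noteq> h j \<bullet> ones_vec n"
  shows "prespinal n D"
proof -
  define S where "S = mat k n (\<lambda>(j, i). h j $ i)"
  have S: "S \<in> carrier_mat k n" by (simp add: S_def)
  have row: "row S j = h j" if "j < k" for j
    using that h[OF that] by (intro eq_vecI) (auto simp: S_def)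
  have Sx: "(S *\<^sub>v x) $ j = h j \<bullet> x" if "j < k" for x j
    using that S by (simp add: row)
  have Scar: "S *\<^sub>v x \<in> carrier_vec k" for x using S by (intro carrier_vecI) simp
  have Seq: "S *\<^sub>v x = y \<longleftrightarrow> (\<forall>j<k. h j \<bullet> x = y $ j)" if "y \<in> carrier_vec k" for x y
  proof
    assume "S *\<^sub>v x = y"
    then show "\<forall>j<k. h j \<bullet> x = y $ j" using Sx by metis
  next
    assume "\<forall>j<k. h j \<bullet> x = y $ j"
    then show "S *\<^sub>v x = y" using that Scar[of x] by (intro eq_vecI) (auto simp: Sx dest!: carrier_vecD)
  qed
  have Dcar: "D \<subseteq> carrier_vec n" "finite D" "D \<noteq> {}"
    using D by (auto simp: simple_equation_def)
  define V where "V = (\<lambda>d. S *\<^sub>v d) ` D"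
  define f where "f = S *\<^sub>v ones_vec n"
  define v where "v j = S *\<^sub>v e j" for j
  have vV: "v ` {..<k} \<subseteq> V" using e by (auto simp: v_def V_def)
  have "V \<subseteq> insert (0\<^sub>v k) (v ` {..<k})"
  proof
    fix y assume "y \<in> V"
    then obtain d where d: "d \<in> D" "y = S *\<^sub>v d" by (auto simp: V_def)
    from cover[OF d(1)] show "y \<in> insert (0\<^sub>v k) (v ` {..<k})"
    proof
      assume "\<forall>j<k. h j \<bullet> d = 0"
      then have "y = 0\<^sub>v k" unfolding d(2) by (subst Seq) auto
      then show ?thesis by simp
    next
      assume "\<exists>i<k. \<forall>j<k. h j \<bullet> d = h j \<bullet> e i"
      then obtain i where "i < k" "\<forall>j<k. h j \<bullet> d = h j \<bullet> e i" by blast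
      then have "y = v i" unfolding d(2) v_def by (subst Seq[OF Scar]) (auto simp: Sx)
      with \<open>i < k\<close> show ?thesis by simp
    qed
  qed
  with vV have V: "V = v ` {..<k} \<or> V = insert (0\<^sub>v k) (v ` {..<k})" by blast
  have "f \<notin> V"
  proof
    assume "f \<in> V"
    then obtain d where d: "d \<in> D" "S *\<^sub>v ones_vec n = S *\<^sub>v d" by (auto simp: V_def f_def)
    with sep[OF d(1)] show False using Sx by metis
  qed
  moreover have "basic_equation k f V"
    unfolding basic_equation_def
  proof (intro conjI allI impI)
    show "f \<in> carrier_vec k" by (simp add: f_def Scar)
    show "finite V" "V \<noteq> {}" "V \<subseteq> carrier_vec k" using Dcar Scar by (auto simp: V_def)
    fix j assume j: "j < k"
    show "0 < f $ j" unfolding f_def Sx[OF j]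
      using pos_scalar_prod_ones[OF h[OF j] _ diag[OF j]] e[OF j] Dcar(1) by auto
    have "v j $ j \<noteq> 0" using diag[OF j] by (simp add: v_def Sx[OF j])
    moreover have "v j \<in> V" using vV j by auto
    ultimately show "\<exists>a\<in>V. a $ j \<noteq> 0" by blast
  qed
  moreover have "\<forall>j<k. v j $ j \<noteq> 0" using diag by (simp add: v_def Sx)
  moreover have "\<forall>i j. i < j \<and> j < k \<longrightarrow> v i $ j = 0" using tri by (simp add: v_def Sx)
  ultimately have "spinal k f V" unfolding spinal_def using k V by blast
  then show ?thesis unfolding prespinal_def using k S f_def V_def by blast
qed

text \<open>
  The spine has one vector for each positive level of \<open>\<sigma>\<close>. On the lowest positive level \<open>\<sigma>\<close> is its
  own separator, which frees the first row to be \<open>\<sigma>\<close>. The last row is positive on the all-ones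
  vector and zero below the top level, so the image of the all-ones vector can only coincide
  with that of a top element; the first row excludes this because \<open>\<sigma> \<bullet> \<one>\<close> is not the top value.
\<close>

lemma missed_maximum_imp_prespinal:
  assumes D: "simple_equation n D" and s: "\<sigma> \<in> carrier_vec n"
    and sep: "\<And>x. x \<in> D \<Longrightarrow> 0 < \<sigma> \<bullet> x \<Longrightarrow> \<exists>g. separator n D \<sigma> x g"
    and t: "t \<in> D" "\<And>d. d \<in> D \<Longrightarrow> \<sigma> \<bullet> d \<le> \<sigma> \<bullet> t" and pos: "0 < \<sigma> \<bullet> t"
    and ne: "\<sigma> \<bullet> ones_vec n \<noteq> \<sigma> \<bullet> t"
  shows "prespinal n D"
proof -
  have Dcar: "D \<subseteq> carrier_vec n" "finite D"
    using D by (auto simp: simple_equation_def)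
  define Q where "Q = (\<lambda>d. \<sigma> \<bullet> d) ` D - {0}"
  have "finite Q" using Dcar by (simp add: Q_def)
  then obtain q where q: "sorted_wrt (<) q" "set q = Q" "length q = card Q"
    by (rule finite_set_strict_sorted)
  define k where "k = length q"
  have qt: "\<sigma> \<bullet> t \<in> set q" using q(2) t(1) pos by (simp add: Q_def)
  then have k: "k \<ge> 1" by (cases q) (auto simp: k_def)
  have less: "q ! i < q ! j" if "i < j" "j < k" for i j
    using sorted_wrt_nth_less[OF q(1)] that by (simp add: k_def)
  have "\<exists>d\<in>D. \<sigma> \<bullet> d = q ! j \<and> 0 < \<sigma> \<bullet> d" if "j < k" for j
  proof -
    have "q ! j \<in> Q" using that q(2) nth_mem by (auto simp: k_def)
    then show ?thesis by (auto simp: Q_def)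
  qed
  then obtain e where e: "\<And>j. j < k \<Longrightarrow> e j \<in> D \<and> \<sigma> \<bullet> e j = q ! j \<and> 0 < \<sigma> \<bullet> e j" by metis
  have "\<exists>g. separator n D \<sigma> (e j) g" if "j < k" for j using sep e[OF that] by blast
  then obtain g where g: "\<And>j. j < k \<Longrightarrow> separator n D \<sigma> (e j) (g j)" by metis
  define h where "h j = (if j = 0 then \<sigma> else g j)" for j
  have first: "q ! 0 \<le> \<sigma> \<bullet> d" if "d \<in> D" "0 < \<sigma> \<bullet> d" for d
  proof -
    have "\<sigma> \<bullet> d \<in> set q" using that q(2) by (simp add: Q_def)
    then obtain j where "j < k" "\<sigma> \<bullet> d = q ! j" by (auto simp: in_set_conv_nth k_def)
    then show ?thesis using less[of 0 j] by (cases "j = 0") auto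
  qed
  have hs: "separator n D \<sigma> (e j) (h j)" if j: "j < k" for j
  proof (cases "j = 0")
    case True
    have "\<sigma> \<bullet> d = 0" if "d \<in> D" "\<sigma> \<bullet> d < \<sigma> \<bullet> e 0" for d
      using first[OF that(1)] that(2) e[of 0] k by (cases "\<sigma> \<bullet> d = 0") auto
    moreover have "0 < \<sigma> \<bullet> e 0" using e[of 0] k by simp
    ultimately have "separator n D \<sigma> (e 0) \<sigma>" using s unfolding separator_def by blast
    then show ?thesis by (simp add: True h_def)
  next
    case False
    with g[OF j] show ?thesis by (simp add: h_def)
  qed
  define l where "l = k - 1"
  have l: "l < k" using k by (simp add: l_def)
  have top: "\<sigma> \<bullet> e l = \<sigma> \<bullet> t"
  proof -
    obtain j where j: "j < k" "\<sigma> \<bullet> t = q ! j" using qt by (auto simp: in_set_conv_nth k_def)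
    have "j = l \<or> j < l" using j(1) unfolding l_def by linarith
    then have "q ! j \<le> q ! l" using less[of j l] l by auto
    moreover have "q ! l \<le> \<sigma> \<bullet> t" using t(2)[of "e l"] e[OF l] by simp
    ultimately show ?thesis using e[OF l] j by simp
  qed
  show ?thesis
  proof (rule prespinalI[OF D k, of h e])
    fix j assume j: "j < k"
    show "h j \<in> carrier_vec n" "0 < h j \<bullet> e j" using separatorD(1,2)[OF hs[OF j]] by auto
    show "e j \<in> D" using e[OF j] by simp
  next
    fix i j assume ij: "i < j" "j < k"
    then have "\<sigma> \<bullet> e i < \<sigma> \<bullet> e j" "e i \<in> D" using less[OF ij] e[of i] e[of j] by auto
    then show "h j \<bullet> e i = 0" using separatorD(4)[OF hs[OF ij(2)]] by blast
  next
    fix d assume d: "d \<in> D"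
    show "(\<forall>j<k. h j \<bullet> d = 0) \<or> (\<exists>i<k. \<forall>j<k. h j \<bullet> d = h j \<bullet> e i)"
    proof (cases "\<sigma> \<bullet> d = 0")
      case True
      have "h j \<bullet> d = 0" if "j < k" for j
        using separatorD(4)[OF hs[OF that] d] e[OF that] True by simp
      then show ?thesis by blast
    next
      case False
      then have "\<sigma> \<bullet> d \<in> set q" using q(2) d by (simp add: Q_def)
      then obtain i where i: "i < k" "\<sigma> \<bullet> d = q ! i" by (auto simp: in_set_conv_nth k_def)
      have "h j \<bullet> d = h j \<bullet> e i" if "j < k" for j
        using separatorD(3)[OF hs[OF that] d] e[OF i(1)] i by simp
      with i show ?thesis by blast
    qed
    show "\<exists>j<k. h j \<bullet> d \<noteq> h j \<bullet> ones_vec n"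
    proof (cases "\<sigma> \<bullet> d = \<sigma> \<bullet> t")
      case True
      with ne k show ?thesis by (intro exI[of _ 0]) (auto simp: h_def)
    next
      case False
      with t(2)[OF d] top have "\<sigma> \<bullet> d < \<sigma> \<bullet> e l" by simp
      then have "h l \<bullet> d = 0" by (rule separatorD(4)[OF hs[OF l] d])
      moreover have "0 < h l \<bullet> ones_vec n"
        using pos_scalar_prod_ones[OF separatorD(1) _ separatorD(2), OF hs[OF l] _ hs[OF l]]
          e[OF l] Dcar(1) by blast
      ultimately show ?thesis using l by force
    qed
  qed
qed

text \<open>
  A separator of a top level vanishes outside that level. With disjoint top levels the two
  separators map \<open>D\<close> to \<open>(a, 0)\<close>, \<open>(0, b)\<close> and possibly \<open>(0, 0)\<close>, whereas the image of the all-ones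
  vector has two positive entries.
\<close>

lemma disjoint_tops_imp_prespinal:
  assumes D: "simple_equation n D"
    and t: "t \<in> D" "\<And>d. d \<in> D \<Longrightarrow> \<sigma> \<bullet> d \<le> \<sigma> \<bullet> t"
    and t': "t' \<in> D" "\<And>d. d \<in> D \<Longrightarrow> \<sigma>' \<bullet> d \<le> \<sigma>' \<bullet> t'"
    and g: "separator n D \<sigma> t g" and g': "separator n D \<sigma>' t' g'"
    and disj: "\<And>d. d \<in> D \<Longrightarrow> \<sigma> \<bullet> d = \<sigma> \<bullet> t \<Longrightarrow> \<sigma>' \<bullet> d \<noteq> \<sigma>' \<bullet> t'"
  shows "prespinal n D"
proof -
  have Dcar: "D \<subseteq> carrier_vec n" using D by (auto simp: simple_equation_def)
  have gz: "g \<bullet> d = (if \<sigma> \<bullet> d = \<sigma> \<bullet> t then g \<bullet> t else 0)" if "d \<in> D" for d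
    using separatorD(3)[OF g that t(1)] separatorD(4)[OF g that] t(2)[OF that] by auto
  have gz': "g' \<bullet> d = (if \<sigma>' \<bullet> d = \<sigma>' \<bullet> t' then g' \<bullet> t' else 0)" if "d \<in> D" for d
    using separatorD(3)[OF g' that t'(1)] separatorD(4)[OF g' that] t'(2)[OF that] by auto
  have pos: "0 < g \<bullet> ones_vec n" "0 < g' \<bullet> ones_vec n"
    using pos_scalar_prod_ones[OF separatorD(1)[OF g] _ separatorD(2)[OF g]]
      pos_scalar_prod_ones[OF separatorD(1)[OF g'] _ separatorD(2)[OF g']] t(1) t'(1) Dcar
    by blast+
  define h where "h j = (if j = 0 then g else g')" for j :: nat
  define e where "e j = (if j = 0 then t else t')" for j :: nat
  have two: "(\<forall>j<2. P j) \<longleftrightarrow> P 0 \<and> P 1" "(\<exists>j<2. P j) \<longleftrightarrow> P 0 \<or> P 1" for P :: "nat \<Rightarrow> bool"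
    by (auto simp: numeral_2_eq_2 less_Suc_eq)
  show ?thesis
  proof (rule prespinalI[OF D, of 2 h e])
    fix j :: nat assume "j < 2"
    show "h j \<in> carrier_vec n" "e j \<in> D" "0 < h j \<bullet> e j"
      using separatorD(1,2)[OF g] separatorD(1,2)[OF g'] t(1) t'(1) by (auto simp: h_def e_def)
  next
    fix i j :: nat assume "i < j" "j < 2"
    then show "h j \<bullet> e i = 0" using gz'[OF t(1)] disj[OF t(1)] by (simp add: h_def e_def)
  next
    fix d assume d: "d \<in> D"
    show "(\<forall>j<2. h j \<bullet> d = 0) \<or> (\<exists>i<2. \<forall>j<2. h j \<bullet> d = h j \<bullet> e i)"
      unfolding two using gz[OF d] gz'[OF d] gz[OF t'(1)] gz'[OF t(1)] disj[OF d] disj[OF t(1)] disj[OF t'(1)]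
      by (auto simp: h_def e_def)
    show "\<exists>j<2. h j \<bullet> d \<noteq> h j \<bullet> ones_vec n"
      unfolding two using gz[OF d] gz'[OF d] disj[OF d] pos by (auto simp: h_def)
  qed simp
qed

lemma spineless_imp_star_star:
  assumes "spineless n D"
  shows "\<exists>K0>1. \<forall>K\<ge>K0. star_star K n D"
proof -
  have D: "simple_equation n D" and np: "\<not> prespinal n D"
    using assms by (auto simp: spineless_def)
  then have Dcar: "D \<subseteq> carrier_vec n" "finite D" "D \<noteq> {}" by (auto simp: simple_equation_def)
  obtain L where L: "\<And>\<sigma> x. \<sigma> \<in> carrier_vec n \<Longrightarrow> x \<in> D \<Longrightarrow> lacunary L D \<sigma> \<Longrightarrow> 0 < \<sigma> \<bullet> x
      \<Longrightarrow> \<exists>g. separator n D \<sigma> x g"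
    using lacunary_imp_separator[OF Dcar(2,1)] by blast
  have top: "\<exists>t\<in>D. (\<forall>d\<in>D. \<sigma> \<bullet> d \<le> \<sigma> \<bullet> t)" for \<sigma>
  proof -
    have "Max ((\<lambda>d. \<sigma> \<bullet> d) ` D) \<in> (\<lambda>d. \<sigma> \<bullet> d) ` D" using Dcar by (intro Max_in) auto
    then obtain t where "t \<in> D" "Max ((\<lambda>d. \<sigma> \<bullet> d) ` D) = \<sigma> \<bullet> t" by auto
    moreover have "\<sigma> \<bullet> d \<le> Max ((\<lambda>d. \<sigma> \<bullet> d) ` D)" if "d \<in> D" for d
      using that Dcar by (intro Max_ge) auto
    ultimately show ?thesis by auto
  qed
  have ones: "\<sigma> \<bullet> t = \<sigma> \<bullet> ones_vec n"
    if s: "\<sigma> \<in> carrier_vec n" and lac: "lacunary L D \<sigma>" and t: "t \<in> D" "\<forall>d\<in>D. \<sigma> \<bullet> d \<le> \<sigma> \<bullet> t" for \<sigma> t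
  \<comment> \<open>If the maximum is zero, then \<open>\<sigma> = 0\<close>, because every variable occurs in some \<open>d \<in> D\<close>.\<close>
  proof (cases "0 < \<sigma> \<bullet> t")
    case True
    then show ?thesis
      using missed_maximum_imp_prespinal[OF D s L[OF s _ lac] t(1)] t(2) np by metis
  next
    case False
    have "\<sigma> $ i = 0" if i: "i < n" for i
    proof -
      obtain d where d: "d \<in> D" "d $ i \<noteq> 0" using D i by (auto simp: simple_equation_def)
      then have dim: "dim_vec d = n" using Dcar by auto
      have "\<sigma> \<bullet> d = 0" using t(2) d(1) False by auto
      then have "\<forall>i<n. \<sigma> $ i * d $ i = 0" by (simp add: scalar_prod_def dim)
      then show ?thesis using d(2) i by auto
    qed
    then have "\<sigma> \<bullet> ones_vec n = 0" by (simp add: scalar_prod_def)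
    with False show ?thesis by simp
  qed
  have "star_star K n D" if K: "K \<ge> L + 2" for K
    unfolding star_star_def
  proof (intro ballI allI impI)
    fix \<sigma> \<sigma>' C C'
    assume s: "\<sigma> \<in> carrier_vec n" "\<sigma>' \<in> carrier_vec n"
      and pow: "\<forall>d\<in>D. C + \<sigma> \<bullet> d \<in> range (\<lambda>m::nat. K ^ m) \<and> C' + \<sigma>' \<bullet> d \<in> range (\<lambda>m::nat. K ^ m)"
    have lac: "lacunary L D \<sigma>" "lacunary L D \<sigma>'"
      using pow K by (auto intro!: power_values_imp_lacunary[of L K D C \<sigma>] power_values_imp_lacunary[of L K D C' \<sigma>'])
    obtain t t' where t: "t \<in> D" "\<forall>d\<in>D. \<sigma> \<bullet> d \<le> \<sigma> \<bullet> t" and t': "t' \<in> D" "\<forall>d\<in>D. \<sigma>' \<bullet> d \<le> \<sigma>' \<bullet> t'"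
      using top by meson
    note o = ones[OF s(1) lac(1) t] ones[OF s(2) lac(2) t']
    have "\<exists>e\<in>D. \<sigma> \<bullet> e = \<sigma> \<bullet> t \<and> \<sigma>' \<bullet> e = \<sigma>' \<bullet> t'"
    proof (rule ccontr)
      assume no: "\<not> ?thesis"
      \<comment> \<open>A weighting with maximum zero is constant on \<open>D\<close>, so the other maximum would be shared.\<close>
      have "0 < \<sigma> \<bullet> t" using no t t' by (metis gr0I le_0_eq)
      moreover have "0 < \<sigma>' \<bullet> t'" using no t t' by (metis gr0I le_0_eq)
      ultimately obtain g g' where "separator n D \<sigma> t g" "separator n D \<sigma>' t' g'"
        using L s lac t t' by meson
      then have "prespinal n D" using disjoint_tops_imp_prespinal[OF D t(1) _ t'(1)] t(2) t'(2) no by blast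
      with np show False by simp
    qed
    with o show "\<exists>e\<in>D. \<sigma> \<bullet> e = \<sigma> \<bullet> ones_vec n \<and> \<sigma>' \<bullet> e = \<sigma>' \<bullet> ones_vec n" by simp
  qed
  then show ?thesis by (intro exI[of _ "L + 2"]) auto
qed

section \<open>Weights taking powers as values on a spine\<close>

text \<open>
  As with digits in a positional system, the highest coordinate in which \<open>x\<close> and \<open>y\<close> differ
  decides which weighted sum is larger.
\<close>

lemma dominant_weights_inj:
  fixes w x y :: "nat \<Rightarrow> nat"
  assumes "\<And>i. i < k \<Longrightarrow> M * (\<Sum>l<i. w l) < w i"
    and "\<And>i. i < k \<Longrightarrow> x i \<le> M" "\<And>i. i < k \<Longrightarrow> y i \<le> M"
    and "(\<Sum>i<k. w i * x i) = (\<Sum>i<k. w i * y i)"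
  shows "\<forall>i<k. x i = y i"
  using assms
proof (induction k)
  case (Suc k)
  have lt: "(\<Sum>i<Suc k. w i * a i) < (\<Sum>i<Suc k. w i * b i)"
    if a: "\<And>i. i < Suc k \<Longrightarrow> a i \<le> M" and ab: "a k < b k" for a b :: "nat \<Rightarrow> nat"
  proof -
    have "(\<Sum>i<k. w i * a i) \<le> (\<Sum>i<k. M * w i)" using a by (intro sum_mono) simp
    also have "\<dots> < w k" using Suc.prems(1)[of k] by (simp add: sum_distrib_left)
    finally have "(\<Sum>i<Suc k. w i * a i) < w k * Suc (a k)" by simp
    also have "\<dots> \<le> w k * b k" using ab by (intro mult_le_mono2) simp
    finally show ?thesis by simp
  qed
  have "x k = y k"
    using lt[of x y] lt[of y x] Suc.prems by (metis less_irrefl linorder_neqE_nat)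
  moreover from this have "\<forall>i<k. x i = y i" using Suc.prems by (intro Suc.IH) auto
  ultimately show ?case by (auto simp: less_Suc_eq)
qed simp

text \<open>
  Solve for \<open>w\<^sub>0, w\<^sub>1, \<dots>\<close> in turn: \<open>w\<^sub>j = (K\<^sup>b - 1 - s) / a\<^sub>j\<^sub>j\<close>, where \<open>s\<close> is the contribution of the
  earlier weights. For the division to be possible at every later step, each weight found is kept
  divisible by all diagonal entries still to come; \<open>K\<^sup>b - 1\<close> has this divisibility as a multiple of
  \<open>K - 1\<close>. The exponent \<open>b\<close> is free, which allows \<open>w\<^sub>j\<close> to dominate the earlier weights.
\<close>

lemma triangular_power_solution:
  fixes a :: "nat \<Rightarrow> nat \<Rightarrow> nat"
  assumes K: "K \<ge> 2" and diag: "\<And>j. j < k \<Longrightarrow> a j j \<noteq> 0"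
    and tri: "\<And>i j. i < j \<Longrightarrow> j < k \<Longrightarrow> a i j = 0"
    and dvd: "(\<Prod>l<k. a l l) dvd K - 1"
  shows "\<exists>w. (\<forall>i<k. M * (\<Sum>l<i. w l) < w i) \<and>
             (\<forall>i<k. 1 + (\<Sum>l<k. w l * a i l) \<in> range (\<lambda>m::nat. K ^ m))"
proof -
  have "\<exists>w. (\<forall>i<j. M * (\<Sum>l<i. w l) < w i) \<and> (\<forall>i<j. (\<Prod>l\<in>{j..<k}. a l l) dvd w i) \<and>
             (\<forall>i<j. 1 + (\<Sum>l<j. w l * a i l) \<in> range (\<lambda>m::nat. K ^ m))" if "j \<le> k" for j
    using that
  proof (induction j)
    case 0
    show ?case by simp
  next
    case (Suc j)
    then obtain w where dom: "\<And>i. i < j \<Longrightarrow> M * (\<Sum>l<i. w l) < w i"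
      and dv: "\<And>i. i < j \<Longrightarrow> (\<Prod>l\<in>{j..<k}. a l l) dvd w i"
      and pw: "\<And>i. i < j \<Longrightarrow> 1 + (\<Sum>l<j. w l * a i l) \<in> range (\<lambda>m::nat. K ^ m)"
      by auto
    have j: "j < k" using Suc.prems by simp
    define P where "P = (\<Prod>l\<in>{Suc j..<k}. a l l)"
    have P: "(\<Prod>l\<in>{j..<k}. a l l) = a j j * P"
      unfolding P_def using j by (simp add: prod.atLeast_Suc_lessThan)
    define s where "s = (\<Sum>l<j. w l * a j l)"
    \<comment> \<open>Any exponent with \<open>K\<^sup>b\<close> above this threshold works, and \<open>b < K\<^sup>b\<close>: the threshold serves itself.\<close>
    define b where "b = 1 + s + a j j * (1 + M * (\<Sum>l<j. w l))"
    have "b < K ^ b" using K by (intro power_gt_expt) simp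
    have "a j j * P dvd K ^ b - 1"
    proof -
      have "a j j * P dvd (\<Prod>l<k. a l l)"
        unfolding P[symmetric] by (rule prod_dvd_prod_subset) auto
      also note dvd
      also have "K - 1 dvd K ^ b - 1"
      proof -
        have "[K = 1] (mod (K - 1))" using K by (simp add: cong_def le_mod_geq)
        then have "[K ^ b = 1] (mod (K - 1))" using cong_pow[of K 1 "K - 1" b] by simp
        then show ?thesis using K by (simp add: cong_altdef_nat)
      qed
      finally show ?thesis .
    qed
    moreover have "a j j * P dvd s"
      unfolding s_def using dv by (intro dvd_sum dvd_mult2) (simp add: P)
    ultimately have "a j j * P dvd K ^ b - 1 - s" by (rule dvd_diff_nat)
    then obtain c where c: "K ^ b - 1 - s = a j j * P * c" ..
    have eq: "1 + s + a j j * (P * c) = K ^ b"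
      using c \<open>b < K ^ b\<close> by (simp add: b_def)
    have big: "M * (\<Sum>l<j. w l) < P * c"
    proof -
      have "a j j * (1 + M * (\<Sum>l<j. w l)) < a j j * (P * c)"
        using eq \<open>b < K ^ b\<close> by (simp add: b_def)
      then have "1 + M * (\<Sum>l<j. w l) < P * c" by (simp only: mult_less_cancel1)
      then show ?thesis by simp
    qed
    define w' where "w' = w(j := P * c)"
    have w': "(\<Sum>l<i. w' l) = (\<Sum>l<i. w l)" "(\<Sum>l<i. w' l * z l) = (\<Sum>l<i. w l * z l)"
      if "i \<le> j" for i z using that by (auto simp: w'_def intro!: sum.cong)
    have "M * (\<Sum>l<i. w' l) < w' i" if "i < Suc j" for i
      using that dom[of i] big w'(1)[of i] by (cases "i = j") (auto simp: w'_def)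
    moreover have "P dvd w' i" if "i < Suc j" for i
      using that dv[of i] unfolding P by (cases "i = j") (auto simp: w'_def dest: dvd_mult_right)
    moreover have "1 + (\<Sum>l<Suc j. w' l * a i l) \<in> range (\<lambda>m::nat. K ^ m)" if "i < Suc j" for i
    proof (cases "i = j")
      case True
      have "1 + (\<Sum>l<Suc j. w' l * a i l) = K ^ b"
        using eq w'(2)[of j "a j"] True by (simp add: w'_def s_def mult.commute)
      then show ?thesis by (metis rangeI)
    next
      case False
      with that have "i < j" by simp
      then have "a i j = 0" by (rule tri) (fact j)
      then show ?thesis using pw[OF \<open>i < j\<close>] w'(2)[of j "a i"] by simp
    qed
    ultimately show ?case unfolding P_def by blast
  qed
  from this[of k] show ?thesis by auto
qed

text \<open>
  The single weighting \<open>\<sigma> = \<Sigma>\<^sup>T w\<close>, taken for both weightings and with \<open>C = C' = 1\<close>, violates the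
  condition. The shift \<open>1\<close> makes the value at a possible zero vector of the spinal equation the
  power \<open>K\<^sup>0\<close>.
\<close>

lemma prespinal_imp_not_star_star:
  assumes D: "simple_equation n D" and pre: "prespinal n D"
  shows "\<exists>K\<ge>K0. \<not> star_star K n D"
proof -
  have Dcar: "D \<subseteq> carrier_vec n" using D by (auto simp: simple_equation_def)
  obtain k S where S: "S \<in> carrier_mat k n"
    and sp: "spinal k (S *\<^sub>v ones_vec n) ((\<lambda>d. S *\<^sub>v d) ` D)"
    using pre by (auto simp: prespinal_def)
  define f where "f = S *\<^sub>v ones_vec n"
  define V where "V = (\<lambda>d. S *\<^sub>v d) ` D"
  obtain v where fV: "f \<notin> V" and V: "V \<subseteq> insert (0\<^sub>v k) (v ` {..<k})"
    and diag: "\<And>j. j < k \<Longrightarrow> v j $ j \<noteq> 0" and tri: "\<And>i j. i < j \<Longrightarrow> j < k \<Longrightarrow> v i $ j = 0"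
    and be: "basic_equation k f V"
    using sp unfolding spinal_def f_def[symmetric] V_def[symmetric] by blast
  have fin: "finite V" and fcar: "f \<in> carrier_vec k" and Vcar: "V \<subseteq> carrier_vec k"
    using be by (auto simp: basic_equation_def)
  define M where "M = (\<Sum>x\<in>insert f V. \<Sum>i<k. x $ i)"
  have M: "x $ i \<le> M" if "x \<in> insert f V" "i < k" for x i
  proof -
    have "x $ i \<le> (\<Sum>i<k. x $ i)" using that(2) by (intro member_le_sum) auto
    also have "\<dots> \<le> M" unfolding M_def using that(1) fin by (intro member_le_sum) auto
    finally show ?thesis .
  qed
  define N where "N = (\<Prod>l<k. v l $ l)"
  have N: "N > 0" using diag by (auto simp: N_def)
  \<comment> \<open>Large, and congruent to \<open>1\<close> modulo the product of the diagonal entries.\<close>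
  define K where "K = 1 + N * (K0 + 1)"
  have "K0 + 1 \<le> N * (K0 + 1)" using N mult_le_mono1[of 1 N "K0 + 1"] by simp
  then have K: "K \<ge> 2" "K \<ge> K0" unfolding K_def by linarith+
  obtain w where dom: "\<And>i. i < k \<Longrightarrow> M * (\<Sum>l<i. w l) < w i"
    and pw: "\<And>i. i < k \<Longrightarrow> 1 + (\<Sum>l<k. w l * v i $ l) \<in> range (\<lambda>m::nat. K ^ m)"
    using triangular_power_solution[of K k "\<lambda>i j. v i $ j" M] K(1) diag tri
    by (auto simp: K_def N_def)
  define \<omega> where "\<omega> = vec k w"
  define \<sigma> where "\<sigma> = transpose_mat S *\<^sub>v \<omega>"
  have scar: "\<sigma> \<in> carrier_vec n" unfolding \<sigma>_def using S by (intro carrier_vecI) simp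
  have wx: "\<omega> \<bullet> x = (\<Sum>l<k. w l * x $ l)" if "x \<in> carrier_vec k" for x
    using that by (simp add: scalar_prod_def \<omega>_def lessThan_atLeast0)
  have Scar: "S *\<^sub>v x \<in> carrier_vec k" for x using S by (intro carrier_vecI) simp
  have sx: "\<sigma> \<bullet> x = (\<Sum>l<k. w l * (S *\<^sub>v x) $ l)" if "x \<in> carrier_vec n" for x
    unfolding \<sigma>_def using transpose_vec_mult_scalar[OF S that, of \<omega>] wx[OF Scar]
    by (simp add: \<omega>_def)
  have "1 + \<sigma> \<bullet> d \<in> range (\<lambda>m::nat. K ^ m)" if d: "d \<in> D" for d
  proof -
    have "S *\<^sub>v d \<in> insert (0\<^sub>v k) (v ` {..<k})" using V d by (auto simp: V_def)
    then consider "S *\<^sub>v d = 0\<^sub>v k" | i where "i < k" "S *\<^sub>v d = v i" by auto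
    then show ?thesis
    proof cases
      case 1
      then have "1 + \<sigma> \<bullet> d = K ^ 0" using sx[of d] d Dcar by auto
      then show ?thesis by (metis rangeI)
    next
      case 2
      then show ?thesis using sx[of d] d Dcar pw[of i] by auto
    qed
  qed
  moreover have "\<sigma> \<bullet> d \<noteq> \<sigma> \<bullet> ones_vec n" if d: "d \<in> D" for d
  proof
    assume "\<sigma> \<bullet> d = \<sigma> \<bullet> ones_vec n"
    then have "(\<Sum>l<k. w l * (S *\<^sub>v d) $ l) = (\<Sum>l<k. w l * f $ l)"
      using sx[of d] sx[of "ones_vec n"] d Dcar by (auto simp: f_def)
    then have "\<forall>i<k. (S *\<^sub>v d) $ i = f $ i"
      using d by (intro dominant_weights_inj[of k M w] dom M) (auto simp: V_def)
    then have "S *\<^sub>v d = f" using carrier_vecD[OF Scar[of d]] carrier_vecD[OF fcar] by (intro eq_vecI) auto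
    with fV d show False by (auto simp: V_def)
  qed
  ultimately have "\<not> star_star K n D"
    unfolding star_star_def using scar by blast
  with K show ?thesis by blast
qed

theorem theorem8p10:
  fixes n :: nat and D :: "nat vec set"
  assumes "simple_equation n D"
  shows "spineless n D \<longleftrightarrow> (\<exists>K0>1. \<forall>K\<ge>K0. star_star K n D)"
proof
  assume "spineless n D"
  then show "\<exists>K0>1. \<forall>K\<ge>K0. star_star K n D" by (rule spineless_imp_star_star)
next
  assume "\<exists>K0>1. \<forall>K\<ge>K0. star_star K n D"
  then show "spineless n D"
    using prespinal_imp_not_star_star[OF assms] assms unfolding spineless_def by blast
qed

end
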